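(* There exists a constant $c>0$ such that for every integer $n \geq 3$, $$r_3(n,n,n) \geq 2^{n^{c \log n}}.$$
   Context: $r_3(n,n,n)$ denotes the minimum $N$ such that every $3$-coloring (coloring with three colors) of the unordered triples of an $N$-element set contains a monochromatic set of size $n$, i.e. an $n$-element subset all of whose triples have the same color. Here $\log$ is the natural logarithm. *)

theory Defs
  imports "HOL-Analysis.Analysis" "HOL-Library.Ramsey"
begin

(* The k-uniform Ramsey number r_k(n_0,...,n_{q-1}): the colours are the indices
   0,...,q-1 of the list ns, and the N-element vertex set is {..<N}. *)
definition hypergraph_ramsey :: "nat \<Rightarrow> nat list \<Rightarrow> nat" where
  "hypergraph_ramsey k ns = (LEAST N. partn_lst {..<N::nat} ns k)"

(* The set of admissible N is nonempty, so the minimum is attained. *)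
lemma partn_lst_hypergraph_ramsey: "partn_lst {..<hypergraph_ramsey k ns} ns k"
  unfolding hypergraph_ramsey_def using ramsey_full [of ns k] by (rule LeastI_ex)

lemma hypergraph_ramsey_le_iff:
  "hypergraph_ramsey k ns \<le> N \<longleftrightarrow> partn_lst {..<N::nat} ns k"
  by (metis Least_le hypergraph_ramsey_def partn_lst_greater_resource
        partn_lst_hypergraph_ramsey)

end

theory Submission
  imports Defs
begin

text \<open>Step up from pairs to triples with three colours instead of four. Given a red/blue colouring of
  the pairs of \<open>{..<M}\<close> and \<open>x < y < z < 2 ^ M\<close>, let \<open>\<delta>\<close> be the position of the highest binary digit in
  which two numbers differ, and colour \<open>{x, y, z}\<close> by the colour of \<open>{\<delta> x y, \<delta> y z}\<close>, where red is split
  in two according to whether \<open>\<delta> x y\<close> or \<open>\<delta> y z\<close> is larger. A set of size \<open>n\<close> in either red colour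
  yields a red clique of size \<open>n - 1\<close>. A blue set of size \<open>n\<close> is the leaf set of a binary tree whose
  root-to-leaf chains of values of \<open>\<delta>\<close> are blue cliques, so it only yields a blue clique of size
  about \<open>log 2 n\<close>. Hence \<open>r\<^sub>3(n, n, n)\<close> exceeds \<open>2 ^ M\<close> for \<open>M\<close> just below the off-diagonal Ramsey number
  of \<open>log 2 n\<close> versus \<open>n\<close>, and a random colouring with blue probability about \<open>n powr (- 1 / 4)\<close>
  shows that this number is at least \<open>n powr (c * ln n)\<close>.\<close>

section \<open>The highest binary digit in which two numbers differ\<close>

definition top_diff :: "nat \<Rightarrow> nat \<Rightarrow> nat" where
  "top_diff x y = (LEAST i. x div 2 ^ Suc i = y div 2 ^ Suc i)"

lemma div_power2_eq_mono:
  fixes x y :: nat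
  assumes "x div 2 ^ i = y div 2 ^ i" "i \<le> j"
  shows "x div 2 ^ j = y div 2 ^ j"
proof -
  have "z div 2 ^ j = z div 2 ^ i div 2 ^ (j - i)" for z :: nat
    using assms(2) by (metis div_mult2_eq le_add_diff_inverse power_add)
  then show ?thesis using assms(1) by metis
qed

text \<open>Agreement above digit \<open>i\<close> persists for larger \<open>i\<close> and holds at
  \<open>i = x + y\<close>. Facts about \<open>top_diff\<close> can then be proved by comparing
  upper bounds.\<close>

lemma top_diff_le_iff: "top_diff x y \<le> i \<longleftrightarrow> x div 2 ^ Suc i = y div 2 ^ Suc i"
proof
  have "x < 2 ^ Suc (x + y)" "y < 2 ^ Suc (x + y)"
    by (metis add_leD1 add_leD2 le_SucI less_exp order_less_le_trans power_increasing one_le_numeral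
        le_refl)+
  then have "x div 2 ^ Suc (x + y) = y div 2 ^ Suc (x + y)" by simp
  then have *: "x div 2 ^ Suc (top_diff x y) = y div 2 ^ Suc (top_diff x y)"
    unfolding top_diff_def by (rule LeastI)
  show "x div 2 ^ Suc i = y div 2 ^ Suc i" if "top_diff x y \<le> i"
    using div_power2_eq_mono[OF *] that by (simp del: power_Suc)
  show "top_diff x y \<le> i" if "x div 2 ^ Suc i = y div 2 ^ Suc i"
    using that unfolding top_diff_def by (rule Least_le)
qed

lemma top_diff_less:
  assumes "x < 2 ^ M" "y < 2 ^ M" "x \<noteq> y"
  shows "top_diff x y < M"
proof (cases M)
  case 0
  then show ?thesis using assms by simp
next
  case (Suc i)
  then have "top_diff x y \<le> i" using assms by (simp add: top_diff_le_iff del: power_Suc)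
  then show ?thesis using Suc by simp
qed

lemma div_less_of_top_diff:
  assumes "x < y"
  shows "x div 2 ^ top_diff x y < y div 2 ^ top_diff x y"
proof (cases "top_diff x y")
  case 0
  then show ?thesis using assms by simp
next
  case (Suc i)
  then have "\<not> top_diff x y \<le> i" by simp
  then have "x div 2 ^ Suc i \<noteq> y div 2 ^ Suc i" by (simp add: top_diff_le_iff)
  then show ?thesis
    using Suc div_le_mono[of x y "2 ^ Suc i"] assms by (simp del: power_Suc)
qed

text \<open>Quotients by a power of 2 keep the order of \<open>x\<close>, \<open>y\<close>,
  \<open>z\<close>, so the outer two coincide exactly when both neighbouring pairs do.\<close>

lemma top_diff_max:
  assumes "x < y" "y < z"
  shows "top_diff x z = max (top_diff x y) (top_diff y z)"
proof -
  have "top_diff x z \<le> i \<longleftrightarrow> max (top_diff x y) (top_diff y z) \<le> i" for i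
    using div_le_mono[of x y "2 ^ Suc i"] div_le_mono[of y z "2 ^ Suc i"] assms
    by (auto simp: top_diff_le_iff simp del: power_Suc)
  then show ?thesis by (metis le_antisym le_refl)
qed

text \<open>With a common value \<open>j\<close>, three distinct quotients by \<open>2 ^ j\<close>
  would have the same half, but only two numbers share a half. Hence
  \<open>{top_diff x y, top_diff y z}\<close> is a genuine pair.\<close>

lemma top_diff_neq:
  assumes "x < y" "y < z"
  shows "top_diff x y \<noteq> top_diff y z"
proof
  assume eq: "top_diff x y = top_diff y z"
  define j where "j = top_diff x y"
  have "x div 2 ^ j < y div 2 ^ j" "y div 2 ^ j < z div 2 ^ j"
    using div_less_of_top_diff assms eq j_def by metis+
  moreover have "x div 2 ^ Suc j = z div 2 ^ Suc j"
    using top_diff_max[OF assms] eq by (simp add: j_def del: power_Suc flip: top_diff_le_iff)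
  then have "x div 2 ^ j div 2 = z div 2 ^ j div 2"
    by (metis div_mult2_eq power_Suc2)
  ultimately show False by linarith
qed

section \<open>Cliques of digit positions forced by large vertex sets\<close>

text \<open>The values of \<^const>\<open>top_diff\<close> on \<open>A\<close> label the inner nodes of a binary tree with leaf set \<open>A\<close>,
  so a large \<open>A\<close> forces a long root-to-leaf chain.\<close>

lemma long_chain_of_large_set:
  assumes "finite A" "2 ^ h < card A"
    and "\<And>x y z. x \<in> A \<Longrightarrow> y \<in> A \<Longrightarrow> z \<in> A \<Longrightarrow> x < y \<Longrightarrow> y < z \<Longrightarrow> P {top_diff x y, top_diff y z}"
  shows "\<exists>B. finite B \<and> card B = Suc h
    \<and> (\<forall>b\<in>B. \<exists>x\<in>A. \<exists>y\<in>A. x < y \<and> b = top_diff x y) \<and> (\<forall>X\<in>nsets B 2. P X)"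
  using assms
proof (induction h arbitrary: A)
  case 0
  then obtain x y where "x \<in> A" "y \<in> A" "x \<noteq> y"
    by (metis card_le_Suc0_iff_eq One_nat_def not_le power_0)
  then obtain x y where "x \<in> A" "y \<in> A" "x < y"
    by (meson nat_neq_iff)
  then show ?case
    by (intro exI[of _ "{top_diff x y}"]) (auto simp: nsets_singleton_iff)
next
  case (Suc h)
  define a where "a = Min A"
  define b where "b = Max A"
  define m where "m = top_diff a b"
  have ne: "A \<noteq> {}" using Suc.prems(2) by auto
  have ab: "a \<in> A" "b \<in> A" and le: "\<And>x. x \<in> A \<Longrightarrow> a \<le> x \<and> x \<le> b"
    using Suc.prems(1) ne by (auto simp: a_def b_def)
  have "a \<noteq> b"
  proof
    assume "a = b"
    then have "A \<subseteq> {a}" using le by force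
    then have "card A \<le> 1" using card_mono[of "{a}" A] by simp
    moreover have "(1::nat) \<le> 2 ^ Suc h" by simp
    ultimately show False using Suc.prems(2) by linarith
  qed
  then have "a < b" using le[OF ab(2)] by simp
  \<comment> \<open>\<open>m\<close> labels the root. A chain found by induction in one subtree has
    all labels below \<open>m\<close>, and \<open>P\<close> joins each of them to \<open>m\<close>,
    so \<open>m\<close> lengthens it by one.\<close>
  have ext: ?case
    if A': "A' \<subseteq> A" "2 ^ h < card A'"
      and low: "\<And>x y. x \<in> A' \<Longrightarrow> y \<in> A' \<Longrightarrow> x < y \<Longrightarrow> top_diff x y < m \<and> P {top_diff x y, m}" for A'
  proof -
    have "finite A'" using A'(1) Suc.prems(1) finite_subset by blast
    moreover have "P {top_diff x y, top_diff y z}"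
      if "x \<in> A'" "y \<in> A'" "z \<in> A'" "x < y" "y < z" for x y z
      using Suc.prems(3)[of x y z] A'(1) that by blast
    ultimately have "\<exists>B. finite B \<and> card B = Suc h
      \<and> (\<forall>b\<in>B. \<exists>x\<in>A'. \<exists>y\<in>A'. x < y \<and> b = top_diff x y) \<and> (\<forall>X\<in>nsets B 2. P X)"
      by (intro Suc.IH A'(2))
    then obtain B where B: "finite B" "card B = Suc h"
      "\<forall>b\<in>B. \<exists>x\<in>A'. \<exists>y\<in>A'. x < y \<and> b = top_diff x y" "\<forall>X\<in>nsets B 2. P X"
      by blast
    have Bm: "c < m \<and> P {c, m}" if "c \<in> B" for c using B(3) low that by metis
    then have "m \<notin> B" by blast
    have "P X" if "X \<in> nsets (insert m B) 2" for X
    proof -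
      obtain c d where X: "c \<in> insert m B" "d \<in> insert m B" "c \<noteq> d" "X = {c, d}"
        using \<open>X \<in> nsets (insert m B) 2\<close> by (rule nsets2_E)
      show ?thesis
      proof (cases "c = m \<or> d = m")
        case True
        then show ?thesis using X Bm by (metis insertE insert_commute)
      next
        case False
        then have "X \<in> nsets B 2" using X by simp
        then show ?thesis using B(4) by blast
      qed
    qed
    moreover have "\<forall>c\<in>insert m B. \<exists>x\<in>A. \<exists>y\<in>A. x < y \<and> c = top_diff x y"
      using B(3) A'(1) ab \<open>a < b\<close> m_def by blast
    ultimately show ?thesis
      using B(1,2) \<open>m \<notin> B\<close> by (intro exI[of _ "insert m B"]) simp
  qed
  \<comment> \<open>The leaves of the two subtrees of the root. The disjunct \<open>x = a\<close> is
    there because \<open>top_diff a a = 0\<close> fails the test when \<open>m = 0\<close>.\<close>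
  define L where "L = {x \<in> A. x = a \<or> top_diff a x < m}"
  define R where "R = A - L"
  have "card A = card L + card R"
    using Suc.prems(1) unfolding R_def L_def
    by (subst card_Diff_subset) (auto simp: card_mono)
  then have "2 ^ h < card L \<or> 2 ^ h < card R"
    using Suc.prems(2) by auto
  then show ?case
  proof
    assume "2 ^ h < card L"
    then show ?thesis
    proof (rule ext[rotated])
      show "L \<subseteq> A" by (auto simp: L_def)
      fix x y assume xy: "x \<in> L" "y \<in> L" "x < y"
      then have inA: "x \<in> A" "y \<in> A" by (auto simp: L_def)
      have ya: "a < y" using xy le inA by (metis le_less_trans)
      then have ym: "top_diff a y < m" using xy by (auto simp: L_def)
      have yb: "y < b" using ym le[OF inA(2)] unfolding m_def by (metis le_neq_implies_less less_irrefl)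
      \<comment> \<open>The step from \<open>y\<close> to \<open>b\<close> crosses the root, so the
        triple \<open>x\<close>, \<open>y\<close>, \<open>b\<close> yields
        \<open>P {top_diff x y, m}\<close>. On the right side the triple \<open>a\<close>,
        \<open>x\<close>, \<open>y\<close> does this.\<close>
      have m: "top_diff y b = m"
        using top_diff_max[OF ya yb] ym unfolding m_def by linarith
      have "top_diff x y < m"
      proof (cases "x = a")
        case True then show ?thesis using ym by simp
      next
        case False
        then have "a < x" using le[OF inA(1)] by simp
        then show ?thesis using top_diff_max[OF _ xy(3)] ym by fastforce
      qed
      moreover have "P {top_diff x y, m}"
        using Suc.prems(3)[OF inA ab(2) xy(3) yb] m by simp
      ultimately show "top_diff x y < m \<and> P {top_diff x y, m}" ..
    qed
  next
    assume "2 ^ h < card R"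
    then show ?thesis
    proof (rule ext[rotated])
      show "R \<subseteq> A" by (auto simp: R_def)
      fix x y assume xy: "x \<in> R" "y \<in> R" "x < y"
      then have inA: "x \<in> A" "y \<in> A" by (auto simp: R_def)
      have eq: "a < z \<and> top_diff a z = m" if "z \<in> R" for z
      proof -
        have z: "z \<in> A" "a < z" "m \<le> top_diff a z"
          using that le by (force simp: R_def L_def)+
        have "top_diff a z \<le> m"
          using top_diff_max[OF z(2), of b] le[OF z(1)] unfolding m_def
          by (metis le_neq_implies_less max.cobounded1 le_refl)
        then show ?thesis using z by simp
      qed
      have "a < x" "top_diff a x = m" "top_diff a y = m" using eq xy by auto
      then have "top_diff x y < m"
        using top_diff_max[of a x y] top_diff_neq[of a x y] xy(3) by simp
      moreover have "P {top_diff x y, m}"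
        using Suc.prems(3)[OF ab(1) inA \<open>a < x\<close> xy(3)] \<open>top_diff a x = m\<close>
        by (simp add: insert_commute)
      ultimately show "top_diff x y < m \<and> P {top_diff x y, m}" ..
    qed
  qed
qed

text \<open>For \<open>x < y < m = Max A\<close> the first difference dominates, so
  \<open>top_diff x m = top_diff x y\<close>. The labels \<open>top_diff x m\<close> thus strictly
  decrease, and any two come from a triple ending in \<open>m\<close>. Only \<open>m\<close> itself
  is lost.\<close>

lemma clique_of_decreasing:
  assumes "finite A" "t < card A"
    and "\<And>x y z. x \<in> A \<Longrightarrow> y \<in> A \<Longrightarrow> z \<in> A \<Longrightarrow> x < y \<Longrightarrow> y < z
      \<Longrightarrow> top_diff y z < top_diff x y \<and> P {top_diff x y, top_diff y z}"
  shows "\<exists>B. finite B \<and> t \<le> card B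
    \<and> (\<forall>b\<in>B. \<exists>x\<in>A. \<exists>y\<in>A. x < y \<and> b = top_diff x y) \<and> (\<forall>X\<in>nsets B 2. P X)"
proof -
  define m where "m = Max A"
  have m: "m \<in> A" and le: "\<And>x. x \<in> A - {m} \<Longrightarrow> x < m"
    using assms(1,2) Max_ge[OF assms(1)] by (auto simp: m_def le_neq_implies_less intro!: Max_in)
  have main: "top_diff y m < top_diff x m \<and> P {top_diff x m, top_diff y m}"
    if "x \<in> A - {m}" "y \<in> A - {m}" "x < y" for x y
    using assms(3)[of x y m] top_diff_max[of x y m] that m le by (auto simp: max_def)
  have inj: "inj_on (\<lambda>x. top_diff x m) (A - {m})"
    using main by (intro linorder_inj_onI') fastforce
  have "P X" if "X \<in> nsets ((\<lambda>x. top_diff x m) ` (A - {m})) 2" for X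
  proof -
    obtain x y where "x \<in> A - {m}" "y \<in> A - {m}" "x \<noteq> y" "X = {top_diff x m, top_diff y m}"
      using \<open>X \<in> _\<close> by (auto elim!: nsets2_E)
    then show ?thesis using main[of x y] main[of y x] by (cases "x < y") (auto simp: insert_commute)
  qed
  moreover have "t \<le> card ((\<lambda>x. top_diff x m) ` (A - {m}))"
    using inj assms(1,2) m by (simp add: card_image)
  ultimately show ?thesis
    using assms(1) m le by (intro exI[of _ "(\<lambda>x. top_diff x m) ` (A - {m})"]) blast
qed

text \<open>Mirror image of \<open>clique_of_decreasing\<close>, with labels taken from the
  minimum.\<close>

lemma clique_of_increasing:
  assumes "finite A" "t < card A"
    and "\<And>x y z. x \<in> A \<Longrightarrow> y \<in> A \<Longrightarrow> z \<in> A \<Longrightarrow> x < y \<Longrightarrow> y < z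
      \<Longrightarrow> top_diff x y < top_diff y z \<and> P {top_diff x y, top_diff y z}"
  shows "\<exists>B. finite B \<and> t \<le> card B
    \<and> (\<forall>b\<in>B. \<exists>x\<in>A. \<exists>y\<in>A. x < y \<and> b = top_diff x y) \<and> (\<forall>X\<in>nsets B 2. P X)"
proof -
  define m where "m = Min A"
  have m: "m \<in> A" and le: "\<And>x. x \<in> A - {m} \<Longrightarrow> m < x"
    using assms(1,2) Min_le[OF assms(1)] by (auto simp: m_def order_less_le intro!: Min_in)
  have main: "top_diff m x < top_diff m y \<and> P {top_diff m x, top_diff m y}"
    if "x \<in> A - {m}" "y \<in> A - {m}" "x < y" for x y
    using assms(3)[of m x y] top_diff_max[of m x y] that m le by (auto simp: max_def)
  have inj: "inj_on (\<lambda>x. top_diff m x) (A - {m})"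
    using main by (intro linorder_inj_onI') fastforce
  have "P X" if "X \<in> nsets ((\<lambda>x. top_diff m x) ` (A - {m})) 2" for X
  proof -
    obtain x y where "x \<in> A - {m}" "y \<in> A - {m}" "x \<noteq> y" "X = {top_diff m x, top_diff m y}"
      using \<open>X \<in> _\<close> by (auto elim!: nsets2_E)
    then show ?thesis using main[of x y] main[of y x] by (cases "x < y") (auto simp: insert_commute)
  qed
  moreover have "t \<le> card ((\<lambda>x. top_diff m x) ` (A - {m}))"
    using inj assms(1,2) m by (simp add: card_image)
  ultimately show ?thesis
    using assms(1) m le by (intro exI[of _ "(\<lambda>x. top_diff m x) ` (A - {m})"]) blast
qed

section \<open>Stepping up from pairs to triples\<close>

text \<open>Pair colour 0 is blue and 1 is red; a triple gets 0 for blue, 1 or 2 for the two kinds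
  of red. Blue costs a logarithm, hence \<open>2 ^ h < n\<close>; red costs one vertex, hence
  \<open>t < n\<close>.\<close>

lemma not_partn_lst_step_up:
  assumes "\<not> partn_lst {..<M} [Suc h, t] 2" "2 ^ h < n" "t < n"
  shows "\<not> partn_lst {..<2 ^ M :: nat} [n, n, n] 3"
proof
  assume part: "partn_lst {..<2 ^ M :: nat} [n, n, n] 3"
  obtain f where f: "f \<in> nsets {..<M} 2 \<rightarrow> {..<2::nat}"
    and nomono: "\<And>i. i < 2 \<Longrightarrow> \<not> monochromatic {..<M} ([Suc h, t] ! i) 2 f i"
    using assms(1) unfolding partn_lst_def by (auto simp: numeral_2_eq_2)
  \<comment> \<open>\<open>monochromatic\<close> fixes the exact size, so a larger clique is first
    cut down.\<close>
  have no: False if B: "i < 2" "finite B" "[Suc h, t] ! i \<le> card B" "B \<subseteq> {..<M}"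
    "\<forall>X\<in>nsets B 2. f X = i" for B i
  proof -
    obtain C where C: "C \<subseteq> B" "finite C" "card C = [Suc h, t] ! i"
      using obtain_subset_with_card_n[OF B(3)] by (metis finite_subset B(2))
    then have "C \<in> nsets {..<M} ([Suc h, t] ! i)" using B(4) by (auto simp: nsets_def)
    moreover have "f ` nsets C 2 \<subseteq> {i}" using B(5) nsets_mono[OF C(1)] by blast
    ultimately show False using nomono[OF B(1)] by (auto simp: monochromatic_def)
  qed
  \<comment> \<open>Sorting recovers \<open>x < y < z\<close> from the unordered triple; 0 is a
    default for sets of other sizes.\<close>
  define g where "g X = (case sorted_list_of_set X of
      [x, y, z] \<Rightarrow> if f {top_diff x y, top_diff y z} = 0 then 0
        else if top_diff y z < top_diff x y then 1 else 2 | _ \<Rightarrow> (0::nat))" for X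
  have g: "g {x, y, z} = (if f {top_diff x y, top_diff y z} = 0 then 0
        else if top_diff y z < top_diff x y then 1 else 2)" if "x < y" "y < z" for x y z
  proof -
    have "sorted_list_of_set (set [x, y, z]) = [x, y, z]"
      using that by (intro sorted_list_of_set.idem_if_sorted_distinct) auto
    then show ?thesis by (simp add: g_def)
  qed
  have "g \<in> nsets {..<2 ^ M} 3 \<rightarrow> {..<length [n, n, n]}"
    by (auto simp: g_def split: list.split)
  with part have "\<exists>i<length [n, n, n]. monochromatic {..<2 ^ M} ([n, n, n] ! i) 3 g i"
    unfolding partn_lst_def by (rule bspec)
  then obtain i where i: "i < length [n, n, n]" "monochromatic {..<2 ^ M} ([n, n, n] ! i) 3 g i"
    by blast
  then have "i < 3" and "[n, n, n] ! i = n" by (auto simp: less_Suc_eq)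
  then obtain A where A: "A \<subseteq> {..<2 ^ M}" "finite A" "card A = n" "g ` nsets A 3 \<subseteq> {i}"
    using i(2) by (auto simp: monochromatic_def nsets_def)
  have gA: "g {x, y, z} = i" if "x \<in> A" "y \<in> A" "z \<in> A" "x < y" "y < z" for x y z
  proof -
    have "{x, y, z} \<in> nsets A 3" using that by (auto simp: nsets_def)
    then show ?thesis using A(4) by blast
  qed
  have f2: "f {top_diff x y, top_diff y z} < 2"
    if "x \<in> A" "y \<in> A" "z \<in> A" "x < y" "y < z" for x y z
  proof -
    have "{top_diff x y, top_diff y z} \<in> nsets {..<M} 2"
      using that A(1) top_diff_neq by (auto simp: subset_iff intro!: top_diff_less)
    then show ?thesis using f by blast
  qed
  have in_M: "B \<subseteq> {..<M}" if "\<forall>b\<in>B. \<exists>x\<in>A. \<exists>y\<in>A. x < y \<and> b = top_diff x y" for B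
    using that A(1) top_diff_less by (fastforce simp: subset_iff)
  consider "i = 0" | "i = 1" | "i = 2" using \<open>i < 3\<close> by linarith
  then show False
  proof cases
    case 1
    have "f {top_diff x y, top_diff y z} = 0"
      if "x \<in> A" "y \<in> A" "z \<in> A" "x < y" "y < z" for x y z
      using gA[OF that] g[OF that(4,5)] 1 by (simp split: if_splits)
    then obtain B where "finite B" "card B = Suc h"
      "\<forall>b\<in>B. \<exists>x\<in>A. \<exists>y\<in>A. x < y \<and> b = top_diff x y" "\<forall>X\<in>nsets B 2. f X = 0"
      using long_chain_of_large_set[OF A(2), of h "\<lambda>X. f X = 0"] A(3) assms(2) by metis
    then show False using no[of 0 B] in_M by simp
  next
    case 2
    have "top_diff y z < top_diff x y \<and> f {top_diff x y, top_diff y z} = 1"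
      if "x \<in> A" "y \<in> A" "z \<in> A" "x < y" "y < z" for x y z
    proof -
      have "g {x, y, z} = 1" using gA[OF that] 2 by simp
      then have "f {top_diff x y, top_diff y z} \<noteq> 0" "top_diff y z < top_diff x y"
        using g[OF that(4,5)] by (metis zero_neq_one numeral_One one_eq_numeral_iff semiring_norm(85))+
      then show ?thesis using f2[OF that] by linarith
    qed
    then obtain B where "finite B" "t \<le> card B"
      "\<forall>b\<in>B. \<exists>x\<in>A. \<exists>y\<in>A. x < y \<and> b = top_diff x y" "\<forall>X\<in>nsets B 2. f X = 1"
      using clique_of_decreasing[OF A(2), of t "\<lambda>X. f X = 1"] A(3) assms(3) by blast
    then show False using no[of 1 B] in_M by simp
  next
    case 3
    have "top_diff x y < top_diff y z \<and> f {top_diff x y, top_diff y z} = 1"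
      if "x \<in> A" "y \<in> A" "z \<in> A" "x < y" "y < z" for x y z
    proof -
      have "g {x, y, z} = 2" using gA[OF that] 3 by simp
      then have "f {top_diff x y, top_diff y z} \<noteq> 0" "\<not> top_diff y z < top_diff x y"
        using g[OF that(4,5)] by (metis zero_neq_numeral one_eq_numeral_iff semiring_norm(85))+
      then show ?thesis using f2[OF that] top_diff_neq[OF that(4,5)] by linarith
    qed
    then obtain B where "finite B" "t \<le> card B"
      "\<forall>b\<in>B. \<exists>x\<in>A. \<exists>y\<in>A. x < y \<and> b = top_diff x y" "\<forall>X\<in>nsets B 2. f X = 1"
      using clique_of_increasing[OF A(2), of t "\<lambda>X. f X = 1"] A(3) assms(3) by blast
    then show False using no[of 1 B] in_M by simp
  qed
qed

section \<open>Off-diagonal graph Ramsey numbers from random colourings\<close>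

text \<open>A uniformly random map into \<open>{..<q}\<close>, with \<open>0\<close> read as the first colour, is the random
  colouring in which the first colour has probability \<open>1 / q\<close>.\<close>

lemma not_partn_lst_random:
  fixes q :: nat
  assumes "q > 0"
    and "real (N choose s) * (1 / q) ^ (s choose k)
      + real (N choose t) * (1 - 1 / q) ^ (t choose k) < 1"
  shows "\<not> partn_lst {..<N} [s, t] k"
proof
  assume part: "partn_lst {..<N} [s, t] k"
  define E where "E = nsets {..<N} k"
  define F where "F = (E \<rightarrow>\<^sub>E {..<q})"
  \<comment> \<open>The event that all \<open>k\<close>-subsets of \<open>H\<close> take values in
    \<open>C\<close>. Probabilities appear as cardinalities relative to
    \<open>card F\<close>.\<close>
  define bad where "bad C H = {g \<in> F. \<forall>X\<in>nsets H k. g X \<in> C}" for C H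
  have fin: "finite E" "finite F"
    by (auto simp: E_def F_def finite_imp_finite_nsets intro!: finite_PiE)
  have cF: "card F = q ^ card E" using fin by (simp add: F_def card_PiE)
  have card_bad: "real (card (bad C H)) = real (card F) * (card C / q) ^ (r choose k)"
    if "C \<subseteq> {..<q}" "H \<in> nsets {..<N} r" for C H r
  proof -
    have H: "H \<subseteq> {..<N}" "card H = r" using that(2) by (auto simp: nsets_def)
    define D where "D = nsets H k"
    have D: "D \<subseteq> E" "card D = r choose k" "finite D"
      using H fin by (auto simp: D_def E_def nsets_mono intro: finite_subset[OF nsets_mono])
    \<comment> \<open>The event constrains each value separately, so it is a product set.\<close>
    have "bad C H = (\<Pi>\<^sub>E X\<in>E. if X \<in> D then C else {..<q})"
      using D(1) that(1) unfolding bad_def F_def D_def[symmetric]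
      by (auto simp: PiE_def Pi_def extensional_def split: if_splits)
    then have "card (bad C H) = (\<Prod>X\<in>E. card (if X \<in> D then C else {..<q}))"
      using fin by (simp add: card_PiE)
    also have "\<dots> = (\<Prod>X\<in>E. if X \<in> D then card C else q)" by (intro prod.cong) auto
    also have "\<dots> = card C ^ card D * q ^ (card E - card D)"
      using fin D
      by (simp add: prod.If_cases Int_absorb1 card_Diff_subset flip: Diff_eq)
    finally have "card (bad C H) = card C ^ card D * q ^ (card E - card D)" .
    moreover have "card D \<le> card E" using D(1) fin by (simp add: card_mono)
    then have "real q ^ (card E - card D) = real q ^ card E / real q ^ card D"
      using assms(1) by (simp add: power_diff)
    ultimately show ?thesis by (simp add: cF D(2) power_divide)
  qed
  have sum_bad: "real (card (\<Union>H\<in>nsets {..<N} r. bad C H))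
      \<le> card F * (real (N choose r) * (card C / q) ^ (r choose k))"
    if "C \<subseteq> {..<q}" for C r
  proof -
    have "card (\<Union>H\<in>nsets {..<N} r. bad C H) \<le> (\<Sum>H\<in>nsets {..<N} r. card (bad C H))"
      by (intro card_UN_le finite_imp_finite_nsets) simp
    then have "real (card (\<Union>H\<in>nsets {..<N} r. bad C H)) \<le> (\<Sum>H\<in>nsets {..<N} r. real (card (bad C H)))"
      by (metis of_nat_le_iff of_nat_sum)
    also have "\<dots> = (\<Sum>H\<in>nsets {..<N} r. real (card F) * (card C / q) ^ (r choose k))"
      using that by (intro sum.cong) (auto simp: card_bad)
    finally show ?thesis by (simp add: mult_ac)
  qed
  \<comment> \<open>The partition relation would make every outcome bad, while the union bound
    counts fewer than \<open>card F\<close> bad ones.\<close>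
  have "F \<subseteq> (\<Union>H\<in>nsets {..<N} s. bad {0} H) \<union> (\<Union>H\<in>nsets {..<N} t. bad {1..<q} H)"
  proof
    fix g assume g: "g \<in> F"
    define f where "f X = (if g X = 0 then 0 else 1::nat)" for X
    have "f \<in> nsets {..<N} k \<rightarrow> {..<length [s, t]}" by (auto simp: f_def)
    then obtain i where i: "i < 2" "monochromatic {..<N} ([s, t] ! i) k f i"
      using part unfolding partn_lst_def by (metis length_Cons list.size(3) Suc_1 One_nat_def)
    then obtain H where H: "H \<in> nsets {..<N} ([s, t] ! i)" "f ` nsets H k \<subseteq> {i}"
      by (auto simp: monochromatic_def)
    have gq: "g X < q" if "X \<in> nsets H k" for X
    proof -
      have "H \<subseteq> {..<N}" using H(1) by (auto simp: nsets_def)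
      then have "X \<in> E" using that nsets_mono E_def by blast
      then show ?thesis using g by (auto simp: F_def)
    qed
    consider "i = 0" | "i = 1" using i(1) by linarith
    then show "g \<in> (\<Union>H\<in>nsets {..<N} s. bad {0} H) \<union> (\<Union>H\<in>nsets {..<N} t. bad {1..<q} H)"
    proof cases
      case 1
      then have "g \<in> bad {0} H"
        using H(2) g by (auto simp: bad_def f_def image_subset_iff split: if_splits)
      then show ?thesis using H(1) 1 by auto
    next
      case 2
      then have "g \<in> bad {1..<q} H"
        using H(2) g gq by (fastforce simp: bad_def f_def image_subset_iff split: if_splits)
      then show ?thesis using H(1) 2 by auto
    qed
  qed
  then have "card F \<le> card (\<Union>H\<in>nsets {..<N} s. bad {0} H) + card (\<Union>H\<in>nsets {..<N} t. bad {1..<q} H)"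
    by (rule order_trans[OF card_mono card_Un_le, rotated])
      (use fin in \<open>auto simp: bad_def finite_imp_finite_nsets\<close>)
  then have "real (card F) \<le> real (card (\<Union>H\<in>nsets {..<N} s. bad {0} H))
      + real (card (\<Union>H\<in>nsets {..<N} t. bad {1..<q} H))"
    by linarith
  also have "\<dots> \<le> card F * (real (N choose s) * (card {0::nat} / q) ^ (s choose k))
      + card F * (real (N choose t) * (card {1..<q} / q) ^ (t choose k))"
    using assms(1) by (intro add_mono sum_bad) auto
  also have "\<dots> = card F * (real (N choose s) * (1 / q) ^ (s choose k)
      + real (N choose t) * (1 - 1 / q) ^ (t choose k))"
    using assms(1) by (simp add: distrib_left diff_divide_distrib of_nat_diff)
  also have "\<dots> < real (card F) * 1"
    using assms(1) by (intro mult_strict_left_mono assms(2)) (simp add: cF)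
  finally show False by simp
qed

lemma one_minus_inverse_power_le_half:
  assumes "q > 0"
  shows "(1 - 1 / real q) ^ q \<le> 1 / 2"
proof -
  have "(1 - 1 / real q) ^ q \<le> exp (- 1 / real q) ^ q"
    using assms exp_ge_add_one_self[of "- 1 / real q"] by (intro power_mono) auto
  also have "\<dots> = exp (- 1)" using assms by (simp flip: exp_of_nat_mult)
  also have "\<dots> \<le> 1 / 2" using exp_ge_add_one_self[of 1] by (simp add: exp_minus field_simps)
  finally show ?thesis .
qed

text \<open>Take \<open>q = 2 ^ k\<close>. In binary exponents, the first term weighs
  \<open>4 * k ^ 3\<close> for choosing the set against \<open>8 * k ^ 3 - 2 * k ^ 2\<close> for its
  probability. The second, with \<open>T = 2 ^ (4 * k - 1)\<close>, weighs \<open>k ^ 2 * T\<close>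
  against roughly \<open>T ^ 2 / 2 ^ (k + 1)\<close>. The terms are at most 1/2 and 1/4.\<close>

lemma not_partn_lst_2_quasipoly:
  assumes "k \<ge> 2"
  shows "\<not> partn_lst {..<2 ^ k\<^sup>2 :: nat} [4 * k, 2 ^ (4 * k - 1)] 2"
proof (rule not_partn_lst_random)
  define T :: nat where "T = 2 ^ (4 * k - 1)"
  have binom: "real ((2 ^ k\<^sup>2) choose r) \<le> 2 ^ (k\<^sup>2 * r)" for r
  proof (cases "r \<le> 2 ^ k\<^sup>2")
    case True
    have "((2 ^ k\<^sup>2) choose r) \<le> (2 ^ k\<^sup>2) ^ r" by (rule binomial_le_pow[OF True])
    then show ?thesis by (metis of_nat_le_iff of_nat_numeral of_nat_power power_mult)
  next
    case False
    then show ?thesis by (simp add: binomial_eq_0)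
  qed
  have exponent1: "k\<^sup>2 * (4 * k) + 1 \<le> k * ((4 * k) choose 2)"
  proof -
    obtain j where k: "k = j + 2" using assms by (metis add.commute le_Suc_ex)
    have "(4 * k) choose 2 = 2 * k * (4 * k - 1)" by (simp add: choose_two)
    then show ?thesis unfolding k by (simp add: algebra_simps power2_eq_square)
  qed
  have "real ((2 ^ k\<^sup>2) choose (4 * k)) * (1 / real (2 ^ k)) ^ ((4 * k) choose 2)
      \<le> 2 ^ (k\<^sup>2 * (4 * k)) * (1 / 2 ^ (k * ((4 * k) choose 2)))"
    by (intro mult_mono binom) (auto simp: power_divide power_mult)
  also have "\<dots> \<le> 2 ^ (k\<^sup>2 * (4 * k)) * (1 / 2 ^ (k\<^sup>2 * (4 * k) + 1))"
    by (intro mult_left_mono divide_left_mono power_increasing exponent1) auto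
  also have "\<dots> = 1 / 2" by simp
  finally have first: "real ((2 ^ k\<^sup>2) choose (4 * k)) * (1 / real (2 ^ k)) ^ ((4 * k) choose 2) \<le> 1 / 2" .
  \<comment> \<open>The induction starts at \<open>k = 2\<close> with
    \<open>5 \<le> 8\<close>.\<close>
  have "k\<^sup>2 + 1 \<le> 2 ^ (3 * k - 3)"
    using assms
  proof (induction k rule: dec_induct)
    case (step m)
    have "2 ^ (3 * Suc m - 3) = 8 * (2 ^ (3 * m - 3) :: nat)"
    proof -
      have "3 * Suc m - 3 = 3 + (3 * m - 3)" using step(1) by simp
      then show ?thesis by (simp only: power_add) simp
    qed
    moreover have "(Suc m)\<^sup>2 + 1 \<le> 8 * (m\<^sup>2 + 1)"
      by (simp add: power2_eq_square) (use le_square[of m] in linarith)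
    then have "(Suc m)\<^sup>2 + 1 \<le> 8 * 2 ^ (3 * m - 3)"
      using step.IH by (meson mult_le_mono2 order_trans)
    ultimately show ?case by simp
  qed simp
  moreover have T2: "T \<ge> 2" unfolding T_def using assms
      power_increasing[of 1 "4 * k - 1" "2::nat"] by simp
  ultimately have exponent2: "k\<^sup>2 * T + 2 \<le> 2 ^ (3 * k - 3) * T"
    using mult_le_mono1[of "k\<^sup>2 + 1" "2 ^ (3 * k - 3)" T] by (simp add: add_mult_distrib)
  \<comment> \<open>Here \<open>T = 4 * 2 ^ k * 2 ^ (3 * k - 3)\<close>, and \<open>T - 1\<close> is
    bounded below by half of \<open>T\<close>.\<close>
  have choose_T: "2 ^ k * (2 ^ (3 * k - 3) * T) \<le> T choose 2"
  proof -
    have "k + (3 * k - 3) + 2 = 4 * k - 1" using assms by linarith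
    then have "2 ^ (k + (3 * k - 3) + 2) = T" unfolding T_def by (simp only:)
    then have "4 * (2 ^ k * 2 ^ (3 * k - 3)) = T" by (simp add: power_add)
    then have "2 * (2 ^ k * 2 ^ (3 * k - 3)) \<le> T - 1" using T2 by linarith
    then have "2 * (2 ^ k * 2 ^ (3 * k - 3)) * T \<le> (T - 1) * T" by (rule mult_le_mono1)
    then have "2 * (2 ^ k * (2 ^ (3 * k - 3) * T)) \<le> T * (T - 1)"
      by (simp only: mult.assoc mult.commute[of "T - 1"])
    then show ?thesis unfolding choose_two by linarith
  qed
  \<comment> \<open>The exponent is grouped into blocks of length \<open>2 ^ k\<close>, each giving
    a factor of at most 1/2.\<close>
  have "(1 - 1 / real (2 ^ k)) ^ (T choose 2) \<le> (1 - 1 / real (2 ^ k)) ^ (2 ^ k * (2 ^ (3 * k - 3) * T))"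
    by (intro power_decreasing choose_T) auto
  also have "\<dots> = ((1 - 1 / real (2 ^ k)) ^ 2 ^ k) ^ (2 ^ (3 * k - 3) * T)"
    by (rule power_mult)
  also have "\<dots> \<le> (1 / 2) ^ (2 ^ (3 * k - 3) * T)"
    using one_minus_inverse_power_le_half[of "2 ^ k"] by (intro power_mono) auto
  also have "\<dots> \<le> (1 / 2) ^ (k\<^sup>2 * T + 2)"
    by (intro power_decreasing exponent2) auto
  finally have "real ((2 ^ k\<^sup>2) choose T) * (1 - 1 / real (2 ^ k)) ^ (T choose 2)
      \<le> 2 ^ (k\<^sup>2 * T) * (1 / 2) ^ (k\<^sup>2 * T + 2)"
    by (intro mult_mono binom) auto
  also have "\<dots> = 1 / 4" by (simp add: power_divide)
  finally have "real ((2 ^ k\<^sup>2) choose T) * (1 - 1 / real (2 ^ k)) ^ (T choose 2) \<le> 1 / 4" .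
  with first show "real ((2 ^ k\<^sup>2) choose (4 * k)) * (1 / real (2 ^ k)) ^ ((4 * k) choose 2)
      + real ((2 ^ k\<^sup>2) choose 2 ^ (4 * k - 1))
        * (1 - 1 / real (2 ^ k)) ^ ((2 ^ (4 * k - 1)) choose 2) < 1"
    unfolding T_def by linarith
qed simp

section \<open>Bounds for triples and the choice of the constant\<close>

lemma hypergraph_ramsey_3_ge_double_exp:
  assumes "k \<ge> 2" "2 ^ (4 * k) \<le> n"
  shows "2 ^ 2 ^ k\<^sup>2 < hypergraph_ramsey 3 [n, n, n]"
proof -
  have "Suc (4 * k - 1) = 4 * k" using assms by simp
  moreover have "(2::nat) ^ (4 * k - 1) < 2 ^ (4 * k)" using assms by simp
  ultimately have "\<not> partn_lst {..<2 ^ 2 ^ k\<^sup>2 :: nat} [n, n, n] 3"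
    using not_partn_lst_step_up[of "2 ^ k\<^sup>2" "4 * k - 1" "2 ^ (4 * k - 1)" n]
      not_partn_lst_2_quasipoly[OF assms(1)] assms(2) by (metis order_less_le_trans)
  then show ?thesis using hypergraph_ramsey_le_iff not_le by blast
qed

text \<open>Even the constant colouring must yield \<open>n\<close> vertices. This serves the small
  \<open>n\<close>.\<close>

lemma hypergraph_ramsey_3_ge: "n \<le> hypergraph_ramsey 3 [n, n, n]"
proof -
  have "\<exists>i<length [n, n, n].
      monochromatic {..<hypergraph_ramsey 3 [n, n, n]} ([n, n, n] ! i) 3 (\<lambda>_. 0) i"
    using partn_lst_hypergraph_ramsey[of 3 "[n, n, n]"] unfolding partn_lst_def
    by (rule bspec) simp
  then obtain H where "H \<in> nsets {..<hypergraph_ramsey 3 [n, n, n]} n"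
    by (auto simp: monochromatic_def less_Suc_eq)
  then have "H \<subseteq> {..<hypergraph_ramsey 3 [n, n, n]}" "card H = n" by (auto simp: nsets_def)
  then show ?thesis by (metis card_lessThan card_mono finite_lessThan)
qed

theorem theorem1p1:
  shows "\<exists>c::real. c > 0 \<and>
    (\<forall>n::nat. n \<ge> 3 \<longrightarrow>
      real (hypergraph_ramsey 3 [n, n, n]) \<ge> 2 powr (real n powr (c * ln (real n))))"
proof (intro exI[of _ "1 / 128 :: real"] conjI allI impI)
  fix n :: nat
  assume n: "n \<ge> 3"
  \<comment> \<open>For large \<open>n\<close>,
    \<open>L\<^sup>2 \<le> 64 * (k\<^sup>2 * ln 2)\<close>, so 1/64 would do there. The further
    factor 1/2 serves small \<open>n\<close>, where the bound has to stay below 3.\<close>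
  define L where "L = ln (real n)"
  have powr: "real n powr (1 / 128 * ln (real n)) = exp (L\<^sup>2 / 128)"
    using n by (simp add: powr_def L_def power2_eq_square)
  have L0: "L \<ge> 0" using n by (simp add: L_def)
  have ln2: "0 < ln (2::real)" "ln (2::real) < 1" using ln2_le_25_over_36 by auto
  show "real (hypergraph_ramsey 3 [n, n, n]) \<ge> 2 powr (real n powr (1 / 128 * ln (real n)))"
  \<comment> \<open>From \<open>2 ^ 8\<close> on, \<open>k = m div 4\<close> is at least 2, as the
    random colouring requires.\<close>
  proof (cases "n < 2 ^ 8")
    case True
    then have "real n < 2 ^ 8" by (metis of_nat_less_iff of_nat_numeral of_nat_power)
    then have "L < 8 * ln 2" unfolding L_def using n ln_realpow[of 2 8]
      by (metis ln_less_cancel_iff of_nat_0_less_iff of_nat_numeral order_less_le_trans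
          zero_less_numeral zero_less_power)
    then have "L\<^sup>2 \<le> (8 * ln 2)\<^sup>2" using L0 by (intro power_mono) auto
    also have "\<dots> \<le> 64 * ln 2" using ln2 by (simp add: power2_eq_square)
    finally have "exp (L\<^sup>2 / 128) \<le> exp (ln 2 / 2)" by simp
    also have "\<dots> = exp (ln (sqrt 2))" by (simp add: ln_sqrt)
    also have "\<dots> = sqrt 2" by simp
    also have "\<dots> \<le> 3 / 2" by (rule real_le_lsqrt) (auto simp: power2_eq_square)
    finally have "2 powr exp (L\<^sup>2 / 128) \<le> 2 powr (3 / 2)" by simp
    also have "\<dots> = sqrt (2 ^ 3)" by (simp add: powr_half_sqrt_powr flip: powr_numeral)
    also have "\<dots> \<le> 3" by (rule real_le_lsqrt) auto
    also have "\<dots> \<le> real n" using n by simp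
    also have "\<dots> \<le> real (hypergraph_ramsey 3 [n, n, n])" using hypergraph_ramsey_3_ge by simp
    finally show ?thesis by (simp only: powr)
  next
    case False
    define m where "m = floor_log n"
    \<comment> \<open>The largest \<open>k\<close> with \<open>2 ^ (4 * k) \<le> n\<close>; the
      rounding is absorbed by \<open>m + 1 \<le> 4 * (k + 1) \<le> 8 * k\<close>.\<close>
    define k where "k = m div 4"
    have m: "2 ^ m \<le> n" "n < 2 ^ Suc m"
      using n floor_log_exp2_le[of n] floor_log_exp2_gt[of n] by (auto simp: m_def)
    have "(2::nat) ^ 8 < 2 ^ Suc m" using m(2) False by linarith
    then have "8 < Suc m" by (rule power_less_imp_less_exp[rotated]) simp
    then have k: "k \<ge> 2" "4 * k \<le> m" "Suc m \<le> 8 * k" by (auto simp: k_def)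
    have "(2::nat) ^ (4 * k) \<le> 2 ^ m" using k(2) by (rule power_increasing) simp
    then have big: "2 ^ 2 ^ k\<^sup>2 < hypergraph_ramsey 3 [n, n, n]"
      using hypergraph_ramsey_3_ge_double_exp[OF k(1)] m(1) by (meson order_trans)
    have "(2::nat) ^ Suc m \<le> 2 ^ (8 * k)" using k(3) by (rule power_increasing) simp
    then have "n \<le> 2 ^ (8 * k)" using m(2) by linarith
    then have "real n \<le> 2 ^ (8 * k)" by (metis of_nat_le_iff of_nat_numeral of_nat_power)
    then have "L \<le> ln (2 ^ (8 * k))" unfolding L_def using n by (subst ln_le_cancel_iff) auto
    then have "L \<le> 8 * k * ln 2" by (simp add: ln_realpow)
    then have "L\<^sup>2 \<le> (8 * k * ln 2)\<^sup>2" using L0 by (intro power_mono) auto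
    also have "\<dots> = 64 * k\<^sup>2 * ln 2 * ln 2" by (simp add: power2_eq_square)
    also have "\<dots> \<le> 64 * k\<^sup>2 * ln 2 * 1" using ln2 by (intro mult_left_mono) auto
    finally have "L\<^sup>2 \<le> 64 * (k\<^sup>2 * ln 2)" by simp
    moreover have "0 \<le> k\<^sup>2 * ln (2::real)" by simp
    ultimately have "L\<^sup>2 / 128 \<le> k\<^sup>2 * ln 2" by linarith
    then have "exp (L\<^sup>2 / 128) \<le> exp (real (k\<^sup>2) * ln 2)" by simp
    also have "\<dots> = 2 ^ k\<^sup>2" by (simp only: exp_of_nat_mult) simp
    finally have "2 powr exp (L\<^sup>2 / 128) \<le> 2 powr (2 ^ k\<^sup>2)" by simp
    also have "\<dots> = 2 powr (real (2 ^ k\<^sup>2))" by simp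
    also have "\<dots> = real (2 ^ 2 ^ k\<^sup>2)" by (simp only: powr_realpow) simp
    also have "\<dots> \<le> real (hypergraph_ramsey 3 [n, n, n])" using big by (simp only: of_nat_le_iff)
    finally show ?thesis by (simp only: powr)
  qed
qed simp

end
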